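(* Let $R(t)\in\mathbb{C}(t)^{m\times n}$ be a rational matrix. Then there exists an additive decomposition of the form $$R(t)=R_{in}(t)+R_{out}(t)+R_{S^1}(t)+R_0,$$ where $R_{in}(t)$ is a strictly proper rational matrix all of whose poles lie in the open unit disk; $R_{out}(t)$ is a rational matrix such that $R_{out}(0)=0$ and all of whose poles (infinity included) lie strictly outside the unit circle; $R_{S^1}(t)$ is a strictly proper rational matrix all of whose poles lie on the unit circle; and $R_0$ is a constant matrix. Moreover, this decomposition is unique. In addition, when $m=n$, $R(z)\in\mathbb{C}(z)^{m\times m}$ is para-Hermitian (resp., para-skew-Hermitian) if and only if $$R_{in}^*(z)=R_{out}(1/z)\qquad(\text{resp., } R_{in}^*(z)=-R_{out}(1/z))$$ and the proper rational matrix $R_p(z):=R_{S^1}(z)+R_0$ is para-Hermitian (resp., para-skew-Hermitian).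
   Context: For a rational matrix $R(t)$ with complex coefficients, $R^*(t):=[R(\overline{t})]^*$ (the coefficients are conjugate-transposed, the variable is not conjugated); i.e. $(R^* )_{ij}(t)=\overline{R_{ji}(\overline{t})}$. A square rational matrix $R(z)$ is para-Hermitian if $R^*(z)=R(1/z)$, and para-skew-Hermitian if $R^*(z)=-R(1/z)$. A rational matrix is proper (resp., strictly proper) if it has a finite limit (resp., limit zero) as $t\to\infty$. "Strictly outside the unit circle" means modulus $>1$ (the point at infinity being allowed as a pole of $R_{out}$). $S^1$ is the unit circle. *)

theory Defs
  imports
    "Jordan_Normal_Form.Matrix"
    "HOL-Computational_Algebra.Polynomial_Factorial"
    "HOL-Computational_Algebra.Field_as_Ring"
    "HOL-Complex_Analysis.Complex_Singularities"
begin

text \<open>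
  The field $\mathbb{C}(t)$ is the fraction field of the complex polynomials, and an
  $m \times n$ rational matrix is an element of \<^term>\<open>carrier_mat m n\<close> over it.
\<close>

type_synonym rat_fun = "complex poly fract"

abbreviation rf_num :: "rat_fun \<Rightarrow> complex poly" where
  "rf_num f \<equiv> fst (quot_of_fract f)"

abbreviation rf_den :: "rat_fun \<Rightarrow> complex poly" where
  "rf_den f \<equiv> snd (quot_of_fract f)"

definition rf_const :: "complex \<Rightarrow> rat_fun" where
  "rf_const c = to_fract [:c:]"

definition rf_var :: rat_fun where
  "rf_var = to_fract [:0, 1:]"

text \<open>
  The quotient is in lowest terms, so the totalised value \<^term>\<open>0 :: complex\<close> occurs,
  other than at zeros of the rational function, exactly at its poles.
\<close>

definition rf_eval :: "rat_fun \<Rightarrow> complex \<Rightarrow> complex" where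
  "rf_eval f z = poly (rf_num f) z / poly (rf_den f) z"

text \<open>
  Substitution \<open>f(g(t))\<close>, computed in $\mathbb{C}(t)$; meaningful for non-constant \<open>g\<close>
  (then the denominator is nonzero), and used only for \<open>g(t) = 1/t\<close>.
\<close>

definition rf_subst :: "rat_fun \<Rightarrow> rat_fun \<Rightarrow> rat_fun" where
  "rf_subst f g =
     poly (map_poly rf_const (rf_num f)) g / poly (map_poly rf_const (rf_den f)) g"

text \<open>Conjugation of the coefficients only: $t \mapsto \overline{f(\overline{t})}$.\<close>

definition rf_cnj :: "rat_fun \<Rightarrow> rat_fun" where
  "rf_cnj f = Fract (map_poly cnj (rf_num f)) (map_poly cnj (rf_den f))"

definition rm_const :: "complex mat \<Rightarrow> rat_fun mat" where
  "rm_const = map_mat rf_const"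

definition rm_star :: "rat_fun mat \<Rightarrow> rat_fun mat" where
  "rm_star R = map_mat rf_cnj (transpose_mat R)"

definition rm_recip :: "rat_fun mat \<Rightarrow> rat_fun mat" where
  "rm_recip R = map_mat (\<lambda>f. rf_subst f (1 / rf_var)) R"

definition para_hermitian :: "rat_fun mat \<Rightarrow> bool" where
  "para_hermitian R \<longleftrightarrow> square_mat R \<and> rm_star R = rm_recip R"

definition para_skew_hermitian :: "rat_fun mat \<Rightarrow> bool" where
  "para_skew_hermitian R \<longleftrightarrow> square_mat R \<and> rm_star R = - rm_recip R"

definition rm_eval :: "rat_fun mat \<Rightarrow> complex \<Rightarrow> complex mat" where
  "rm_eval R z = map_mat (\<lambda>f. rf_eval f z) R"

text \<open>Limits of matrices are taken entrywise.\<close>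

definition rm_proper :: "rat_fun mat \<Rightarrow> bool" where
  "rm_proper R \<longleftrightarrow>
     (\<forall>i < dim_row R. \<forall>j < dim_col R. \<exists>L. (rf_eval (R $$ (i, j)) \<longlongrightarrow> L) at_infinity)"

definition rm_strictly_proper :: "rat_fun mat \<Rightarrow> bool" where
  "rm_strictly_proper R \<longleftrightarrow>
     (\<forall>i < dim_row R. \<forall>j < dim_col R. (rf_eval (R $$ (i, j)) \<longlongrightarrow> 0) at_infinity)"

text \<open>The finite poles, i.e. the points of the complex plane at which some entry has a pole.\<close>

definition rm_poles :: "rat_fun mat \<Rightarrow> complex set" where
  "rm_poles R =
     {z. \<exists>i < dim_row R. \<exists>j < dim_col R. is_pole (rf_eval (R $$ (i, j))) z}"

text \<open>
  Infinity lies strictly outside the unit circle. Hence it is no restriction on the poles of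
  \<open>Rout\<close>, while strict properness already excludes it as a pole of \<open>Rin\<close> and \<open>RS\<close>.
\<close>

definition circle_decomposition ::
  "rat_fun mat \<Rightarrow> rat_fun mat \<Rightarrow> rat_fun mat \<Rightarrow> rat_fun mat \<Rightarrow> complex mat \<Rightarrow> bool" where
  "circle_decomposition R Rin Rout RS R0 \<longleftrightarrow>
     Rin \<in> carrier_mat (dim_row R) (dim_col R) \<and>
     Rout \<in> carrier_mat (dim_row R) (dim_col R) \<and>
     RS \<in> carrier_mat (dim_row R) (dim_col R) \<and>
     R0 \<in> carrier_mat (dim_row R) (dim_col R) \<and>
     R = Rin + Rout + RS + rm_const R0 \<and>
     rm_strictly_proper Rin \<and> (\<forall>z \<in> rm_poles Rin. cmod z < 1) \<and>
     rm_eval Rout 0 = 0\<^sub>m (dim_row R) (dim_col R) \<and> (\<forall>z \<in> rm_poles Rout. cmod z > 1) \<and>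
     rm_strictly_proper RS \<and> (\<forall>z \<in> rm_poles RS. cmod z = 1)"

end

theory Submission
  imports Defs "HOL-Computational_Algebra.Fundamental_Theorem_Algebra"
begin

text \<open>
  Everything happens entrywise. Factoring the denominator according to whether its roots lie
  inside, on or outside the unit circle, Bezout's identity splits a rational function into
  summands with poles in these three regions; division with remainder makes the first two
  strictly proper, and the constant is the value at \<open>0\<close> of the third. Conversely, a rational
  function whose poles lie in two disjoint regions is a polynomial, so the classes
  (strictly proper, poles inside), (zero at \<open>0\<close>, poles outside), (proper, poles on the circle)
  form a direct sum. Conjugation of the coefficients preserves the three classes, while
  \<open>t \<mapsto> 1/t\<close> swaps the first two and preserves the third. Comparing components of both
  sides of \<open>R\<^sup>*(z) = \<plusminus> R(1/z)\<close> gives the symmetry statement; the condition on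
  \<open>Rout\<^sup>*\<close> is equivalent to the one on \<open>Rin\<^sup>*\<close> since both operations are commuting
  involutions.
\<close>

section \<open>Limits and poles of polynomial quotients\<close>

lemma poly_nonzero_eventually_at_infinity:
  fixes p :: "complex poly"
  assumes "p \<noteq> 0"
  shows "eventually (\<lambda>z. poly p z \<noteq> 0) at_infinity"
proof -
  have "bounded {z. poly p z = 0}"
    using poly_roots_finite[OF assms] by (rule finite_imp_bounded)
  then obtain b where b: "\<And>z. poly p z = 0 \<Longrightarrow> norm z \<le> b"
    unfolding bounded_iff by blast
  show ?thesis
  proof (rule eventually_at_infinityI[of "b + 1"])
    fix z :: complex assume "b + 1 \<le> norm z"
    then show "poly p z \<noteq> 0"
      using b[of z] by auto
  qed
qed

text \<open>For equal degrees, dividing numerator and denominator by the same power of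
  \<open>z\<close> shows that the limit is the ratio of the leading coefficients; for a smaller
  degree of \<open>p\<close> the limit is 0.\<close>

lemma poly_divide_convergent_at_infinity:
  fixes p q :: "complex poly"
  assumes "q \<noteq> 0" "degree p \<le> degree q"
  shows "\<exists>L. ((\<lambda>z. poly p z / poly q z) \<longlongrightarrow> L) at_infinity"
proof (cases "degree p = degree q")
  case True
  have "((\<lambda>z. (poly p z / z ^ degree p) / (poly q z / z ^ degree q)) \<longlongrightarrow>
      lead_coeff p / lead_coeff q) at_infinity"
    using assms by (intro tendsto_divide poly_divide_tendsto_aux) auto
  moreover have "\<forall>\<^sub>F z in at_infinity.
      (poly p z / z ^ degree p) / (poly q z / z ^ degree q) = poly p z / poly q z"
    by (rule eventually_at_infinityI[of 1]) (auto simp: True)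
  ultimately show ?thesis
    by (intro exI) (rule Lim_transform_eventually)
next
  case False
  then show ?thesis
    using assms poly_divide_tendsto_0_at_infinity[of p q] by force
qed

lemma poly_divide_tendsto_0_at_infinity_iff:
  fixes p q :: "complex poly"
  assumes "q \<noteq> 0"
  shows "((\<lambda>z. poly p z / poly q z) \<longlongrightarrow> 0) at_infinity \<longleftrightarrow> p = 0 \<or> degree p < degree q"
proof
  assume lim: "((\<lambda>z. poly p z / poly q z) \<longlongrightarrow> 0) at_infinity"
  show "p = 0 \<or> degree p < degree q"
  \<comment> \<open>If \<open>degree q \<le> degree p\<close>, the reciprocal quotient converges as
    well, so the product of the two tends to 0; but this product is eventually 1.\<close>
  proof (rule ccontr)
    assume "\<not> (p = 0 \<or> degree p < degree q)"
    then have p: "p \<noteq> 0" "degree q \<le> degree p" by auto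
    then obtain L where "((\<lambda>z. poly q z / poly p z) \<longlongrightarrow> L) at_infinity"
      using poly_divide_convergent_at_infinity by blast
    then have "((\<lambda>z. (poly p z / poly q z) * (poly q z / poly p z)) \<longlongrightarrow> 0 * L) at_infinity"
      using lim by (intro tendsto_mult)
    moreover have "\<forall>\<^sub>F z in at_infinity. (poly p z / poly q z) * (poly q z / poly p z) = 1"
      using poly_nonzero_eventually_at_infinity[OF p(1)]
        poly_nonzero_eventually_at_infinity[OF assms]
      by eventually_elim auto
    ultimately have "((\<lambda>z::complex. 1::complex) \<longlongrightarrow> 0 * L) at_infinity"
      by (rule Lim_transform_eventually)
    then show False
      using tendsto_const_iff[of "at_infinity :: complex filter" "1::complex" 0]
        trivial_limit_at_infinity by auto
  qed
next
  assume "p = 0 \<or> degree p < degree q"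
  then show "((\<lambda>z. poly p z / poly q z) \<longlongrightarrow> 0) at_infinity"
    using poly_divide_tendsto_0_at_infinity[of p q] by auto
qed

text \<open>Coprimality keeps the numerator away from 0 at a root of \<open>q\<close>. Since the
  roots of \<open>q\<close> are isolated, \<open>q\<close> tends to 0 there through nonzero values,
  and the quotient blows up.\<close>

lemma is_pole_poly_divide_iff:
  fixes p q :: "complex poly"
  assumes "coprime p q" "q \<noteq> 0"
  shows "is_pole (\<lambda>z. poly p z / poly q z) z \<longleftrightarrow> poly q z = 0"
proof
  assume pole: "is_pole (\<lambda>z. poly p z / poly q z) z"
  show "poly q z = 0"
  proof (rule ccontr)
    assume "poly q z \<noteq> 0"
    then have "((\<lambda>z. poly p z / poly q z) \<longlongrightarrow> poly p z / poly q z) (at z)"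
      by (intro tendsto_intros) auto
    then show False
      using pole not_tendsto_and_filterlim_at_infinity[of "at z"]
      unfolding is_pole_def by auto
  qed
next
  assume q: "poly q z = 0"
  then have p: "poly p z \<noteq> 0"
    using coprime_poly_0[OF assms(1), of z] by auto
  have "(poly q \<longlongrightarrow> 0) (at z)"
    using q by (auto intro!: tendsto_eq_intros)
  moreover have "\<forall>\<^sub>F w in at z. poly q w \<noteq> 0"
    using islimpt_finite[OF poly_roots_finite[OF assms(2)], of z]
    by (simp add: islimpt_iff_eventually)
  ultimately have "filterlim (poly q) (at 0) (at z)"
    by (simp add: filterlim_at)
  then show "is_pole (\<lambda>z. poly p z / poly q z) z"
    using p by (intro is_pole_divide) auto
qed

section \<open>Rational functions with prescribed poles\<close>

definition poles_in :: "complex set \<Rightarrow> rat_fun \<Rightarrow> bool" where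
  "poles_in S f \<longleftrightarrow> (\<forall>z. poly (rf_den f) z = 0 \<longrightarrow> z \<in> S)"

definition proper :: "rat_fun \<Rightarrow> bool" where
  "proper f \<longleftrightarrow> degree (rf_num f) \<le> degree (rf_den f)"

text \<open>Zero needs its own disjunct: it is represented as 0/1, and both polynomials have degree
  0.\<close>

definition strictly_proper :: "rat_fun \<Rightarrow> bool" where
  "strictly_proper f \<longleftrightarrow> f = 0 \<or> degree (rf_num f) < degree (rf_den f)"

lemma is_pole_rf_eval_iff: "is_pole (rf_eval f) z \<longleftrightarrow> poly (rf_den f) z = 0"
  unfolding rf_eval_def
  by (rule is_pole_poly_divide_iff) (simp_all add: coprime_quot_of_fract)

lemma rf_eval_tendsto_0_iff: "(rf_eval f \<longlongrightarrow> 0) at_infinity \<longleftrightarrow> strictly_proper f"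
  unfolding rf_eval_def strictly_proper_def
  by (subst poly_divide_tendsto_0_at_infinity_iff) simp_all

lemma proper_imp_convergent: "proper f \<Longrightarrow> \<exists>L. (rf_eval f \<longlongrightarrow> L) at_infinity"
  unfolding rf_eval_def proper_def
  by (rule poly_divide_convergent_at_infinity) simp_all

section \<open>Reading off poles, values and degrees from arbitrary fractions\<close>

lemma rf_cases:
  obtains p q where "f = Fract p q" "q \<noteq> 0" "rf_num f = p" "rf_den f = q"
  using Fract_quot_of_fract[of f] snd_quot_of_fract_nonzero[of f] by metis

lemma Fract_lowest_terms:
  "q \<noteq> 0 \<Longrightarrow> rf_num (Fract p q) * q = p * rf_den (Fract p q)"
  using eq_fract(1)[of "rf_den (Fract p q)" q "rf_num (Fract p q)" p] by simp

text \<open>The reduced denominator divides \<open>rf_num (Fract p q) * q\<close> and is coprime to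
  the first factor.\<close>

lemma rf_den_Fract_dvd:
  assumes "q \<noteq> 0"
  shows "rf_den (Fract p q) dvd q"
proof -
  have "rf_den (Fract p q) dvd rf_num (Fract p q) * q"
    by (simp add: Fract_lowest_terms[OF assms])
  then show ?thesis
    using coprime_quot_of_fract[of "Fract p q"]
    by (simp add: coprime_dvd_mult_right_iff coprime_commute)
qed

lemma poly_rf_den_Fract_eq_0:
  assumes "q \<noteq> 0" "poly (rf_den (Fract p q)) z = 0"
  shows "poly q z = 0"
proof -
  obtain k where "q = rf_den (Fract p q) * k"
    using rf_den_Fract_dvd[OF assms(1)] by (rule dvdE)
  then have "poly q z = poly (rf_den (Fract p q)) z * poly k z"
    by (metis poly_mult)
  with assms(2) show ?thesis by simp
qed

text \<open>Only this direction is available for an arbitrary fraction, since roots of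
  \<open>q\<close> may cancel against \<open>p\<close>.\<close>

lemma poles_in_Fract:
  assumes "q \<noteq> 0" "\<And>z. poly q z = 0 \<Longrightarrow> z \<in> S"
  shows "poles_in S (Fract p q)"
  unfolding poles_in_def using poly_rf_den_Fract_eq_0[OF assms(1)] assms(2) by blast

lemma rf_eval_Fract:
  assumes "poly q z \<noteq> 0"
  shows "rf_eval (Fract p q) z = poly p z / poly q z"
proof -
  have q: "q \<noteq> 0" using assms by auto
  have "poly (rf_den (Fract p q)) z \<noteq> 0"
    using poly_rf_den_Fract_eq_0[OF q] assms by blast
  moreover have "poly (rf_num (Fract p q)) z * poly q z = poly p z * poly (rf_den (Fract p q)) z"
    using Fract_lowest_terms[OF q, of p] by (metis poly_mult)
  ultimately show ?thesis
    using assms by (simp add: rf_eval_def field_simps)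
qed

lemma Fract_eq_0_iff: "q \<noteq> 0 \<Longrightarrow> Fract p q = 0 \<longleftrightarrow> p = 0"
  for p q :: "'a::idom"
  by (simp add: Zero_fract_def eq_fract)

text \<open>The difference of the degrees of numerator and denominator is independent of the
  representation, so properness can be tested on any fraction.\<close>

lemma degree_rf_Fract:
  assumes "q \<noteq> 0" "p \<noteq> 0"
  shows "degree (rf_num (Fract p q)) + degree q = degree p + degree (rf_den (Fract p q))"
proof -
  have "rf_num (Fract p q) \<noteq> 0"
    using assms by (simp add: Fract_eq_0_iff)
  then show ?thesis
    using Fract_lowest_terms[OF assms(1), of p] assms
    by (metis degree_mult_eq snd_quot_of_fract_nonzero)
qed

lemma proper_Fract: "q \<noteq> 0 \<Longrightarrow> proper (Fract p q) \<longleftrightarrow> degree p \<le> degree q"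
  using degree_rf_Fract[of q p]
  by (cases "p = 0") (auto simp: proper_def fract_collapse)

lemma strictly_proper_Fract:
  "q \<noteq> 0 \<Longrightarrow> strictly_proper (Fract p q) \<longleftrightarrow> p = 0 \<or> degree p < degree q"
  using degree_rf_Fract[of q p]
  by (cases "p = 0") (auto simp: strictly_proper_def fract_collapse Fract_eq_0_iff)

section \<open>Constants, negation, sums and differences\<close>

lemma poles_in_mono: "poles_in S f \<Longrightarrow> S \<subseteq> T \<Longrightarrow> poles_in T f"
  by (auto simp: poles_in_def)

lemma poles_in_const [simp]: "poles_in S (rf_const c)"
  unfolding rf_const_def to_fract_def by (rule poles_in_Fract) auto

lemma proper_const [simp]: "proper (rf_const c)"
  by (simp add: rf_const_def to_fract_def proper_Fract)

lemma strictly_proper_const_iff: "strictly_proper (rf_const c) \<longleftrightarrow> c = 0"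
  by (simp add: rf_const_def to_fract_def strictly_proper_Fract)

lemma rf_eval_const [simp]: "rf_eval (rf_const c) z = c"
  by (simp add: rf_const_def to_fract_def rf_eval_Fract)

lemma rf_const_0 [simp]: "rf_const 0 = 0"
  by (simp add: rf_const_def)

lemma rf_const_add: "rf_const (a + b) = rf_const a + rf_const b"
  by (simp add: rf_const_def flip: to_fract_add)

lemma rf_const_uminus: "rf_const (- a) = - rf_const a"
  by (simp add: rf_const_def flip: to_fract_uminus)

lemma rf_const_diff: "rf_const (a - b) = rf_const a - rf_const b"
  using rf_const_add[of a "- b"] by (simp add: rf_const_uminus)

lemma strictly_proper_imp_proper: "strictly_proper f \<Longrightarrow> proper f"
  by (auto simp: strictly_proper_def proper_def)

lemma poles_in_uminus [simp]: "poles_in S (- f) \<longleftrightarrow> poles_in S f"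
  by (simp add: poles_in_def quot_of_fract_uminus case_prod_unfold Let_def)

lemma proper_uminus [simp]: "proper (- f) \<longleftrightarrow> proper f"
  by (simp add: proper_def quot_of_fract_uminus case_prod_unfold Let_def)

lemma strictly_proper_uminus [simp]: "strictly_proper (- f) \<longleftrightarrow> strictly_proper f"
  by (simp add: strictly_proper_def quot_of_fract_uminus case_prod_unfold Let_def)

lemma rf_eval_uminus [simp]: "rf_eval (- f) z = - rf_eval f z"
  by (simp add: rf_eval_def quot_of_fract_uminus case_prod_unfold Let_def)

lemma poles_in_add:
  assumes "poles_in S f" "poles_in S g"
  shows "poles_in S (f + g)"
proof (cases f rule: rf_cases; cases g rule: rf_cases)
  fix p q p' q'
  assume "f = Fract p q" "q \<noteq> 0" "rf_den f = q" "g = Fract p' q'" "q' \<noteq> 0" "rf_den g = q'"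
  moreover from this assms have "\<forall>z. poly q z = 0 \<or> poly q' z = 0 \<longrightarrow> z \<in> S"
    by (auto simp: poles_in_def)
  ultimately show ?thesis
    by (auto intro!: poles_in_Fract)
qed

lemma proper_add:
  assumes "proper f" "proper g"
  shows "proper (f + g)"
proof (cases f rule: rf_cases; cases g rule: rf_cases)
  fix p q p' q'
  assume *: "f = Fract p q" "q \<noteq> 0" "g = Fract p' q'" "q' \<noteq> 0"
  with assms have "degree p \<le> degree q" "degree p' \<le> degree q'"
    by (simp_all add: proper_Fract)
  then have "degree (p * q') \<le> degree q + degree q'" "degree (p' * q) \<le> degree q + degree q'"
    by (auto intro: order.trans[OF degree_mult_le])
  then have "degree (p * q' + p' * q) \<le> degree q + degree q'"
    by (rule degree_add_le)
  with * show ?thesis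
    by (simp add: proper_Fract degree_mult_eq)
qed

lemma proper_add_const: "strictly_proper f \<Longrightarrow> proper (f + rf_const c)"
  by (simp add: proper_add strictly_proper_imp_proper)

lemma strictly_proper_add:
  assumes "strictly_proper f" "strictly_proper g"
  shows "strictly_proper (f + g)"
proof (cases f rule: rf_cases; cases g rule: rf_cases)
  fix p q p' q'
  assume *: "f = Fract p q" "q \<noteq> 0" "g = Fract p' q'" "q' \<noteq> 0"
  with assms have "p = 0 \<or> degree p < degree q" "p' = 0 \<or> degree p' < degree q'"
    by (simp_all add: strictly_proper_Fract)
  then have "p = 0 \<or> degree (p * q') < degree q + degree q'"
      "p' = 0 \<or> degree (p' * q) < degree q + degree q'"
    using degree_mult_le[of p q'] degree_mult_le[of p' q] by auto
  then have "p * q' + p' * q = 0 \<or> degree (p * q' + p' * q) < degree q + degree q'"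
    by (auto intro: degree_add_less)
  with * show ?thesis
    by (simp add: strictly_proper_Fract degree_mult_eq)
qed

lemma rf_eval_add:
  assumes "poles_in S f" "poles_in S g" "z \<notin> S"
  shows "rf_eval (f + g) z = rf_eval f z + rf_eval g z"
proof (cases f rule: rf_cases; cases g rule: rf_cases)
  fix p q p' q'
  assume *: "f = Fract p q" "q \<noteq> 0" "rf_den f = q" "g = Fract p' q'" "q' \<noteq> 0" "rf_den g = q'"
  with assms have "poly q z \<noteq> 0" "poly q' z \<noteq> 0"
    by (auto simp: poles_in_def)
  with * show ?thesis
    by (simp add: rf_eval_Fract add_frac_eq)
qed

lemma poles_in_diff: "poles_in S f \<Longrightarrow> poles_in S g \<Longrightarrow> poles_in S (f - g)"
  using poles_in_add[of S f "- g"] by simp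

lemma proper_diff: "proper f \<Longrightarrow> proper g \<Longrightarrow> proper (f - g)"
  using proper_add[of f "- g"] by simp

lemma strictly_proper_diff: "strictly_proper f \<Longrightarrow> strictly_proper g \<Longrightarrow> strictly_proper (f - g)"
  using strictly_proper_add[of f "- g"] by simp

lemma rf_eval_diff:
  "poles_in S f \<Longrightarrow> poles_in S g \<Longrightarrow> z \<notin> S \<Longrightarrow> rf_eval (f - g) z = rf_eval f z - rf_eval g z"
  using rf_eval_add[of S f "- g"] by simp

section \<open>The additive decomposition of a rational function\<close>

text \<open>A nonconstant denominator would have a complex root, and this root would lie in both
  sets. Hence \<open>f\<close> is a polynomial.\<close>

lemma poles_in_disjoint_imp_degree_0:
  assumes "poles_in S f" "poles_in T f" "S \<inter> T = {}"
  shows "degree (rf_den f) = 0"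
  using assms alg_closed_imp_poly_has_root[of "rf_den f"]
  by (auto simp: poles_in_def)

text \<open>Directness of the sum. As \<open>a = - (b + w)\<close>, the poles of \<open>a\<close>
  avoid every region, so \<open>a\<close> is a strictly proper polynomial, that is 0. Then
  \<open>b = - w\<close> is a proper polynomial, hence constant, and it vanishes at 0.\<close>

lemma sum_poles_in_eq_0:
  assumes "poles_in {z. cmod z < 1} a" "strictly_proper a"
    and "poles_in {z. cmod z > 1} b" "rf_eval b 0 = 0"
    and "poles_in {z. cmod z = 1} w" "proper w"
    and sum: "a + b + w = 0"
  shows "a = 0 \<and> b = 0 \<and> w = 0"
proof -
  have "a = - (b + w)"
    using sum by (metis add.assoc eq_neg_iff_add_eq_0)
  moreover have "poles_in {z. cmod z \<ge> 1} (b + w)"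
    by (rule poles_in_add) (rule poles_in_mono, rule assms, auto)+
  ultimately have "poles_in {z. cmod z \<ge> 1} a"
    by (simp only: poles_in_uminus)
  then have "degree (rf_den a) = 0"
    by (intro poles_in_disjoint_imp_degree_0[OF assms(1)]) auto
  with assms(2) have a: "a = 0"
    by (simp add: strictly_proper_def)
  with sum have bw: "b = - w"
    by (simp add: eq_neg_iff_add_eq_0)
  have "degree (rf_den b) = 0"
    by (rule poles_in_disjoint_imp_degree_0[OF assms(3), of "{z. cmod z = 1}"])
      (use assms(5) in \<open>auto simp: bw\<close>)
  moreover have "degree (rf_num b) \<le> degree (rf_den b)"
    using assms(6) bw proper_uminus[of w] by (simp add: proper_def)
  ultimately obtain c d where cd: "rf_num b = [:c:]" "rf_den b = [:d:]"
    by (metis degree_eq_zeroE le_zero_eq)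
  then have "d \<noteq> 0"
    using snd_quot_of_fract_nonzero[of b] by auto
  then have "rf_num b = 0"
    using assms(4) cd by (simp add: rf_eval_def)
  then show ?thesis
    using a bw by simp
qed

text \<open>The circle part \<open>w\<close> absorbs the constant and is only required to be proper:
  unlike strict properness, this is stable under t -> 1/t for functions without a pole at 0.\<close>

lemma decomposition_unique:
  assumes "poles_in {z. cmod z < 1} a" "strictly_proper a"
    and "poles_in {z. cmod z > 1} b" "rf_eval b 0 = 0"
    and "poles_in {z. cmod z = 1} w" "proper w"
    and "poles_in {z. cmod z < 1} a'" "strictly_proper a'"
    and "poles_in {z. cmod z > 1} b'" "rf_eval b' 0 = 0"
    and "poles_in {z. cmod z = 1} w'" "proper w'"
  shows "a + b + w = a' + b' + w' \<longleftrightarrow> a = a' \<and> b = b' \<and> w = w'"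
proof
  assume "a + b + w = a' + b' + w'"
  then have "(a - a') + (b - b') + (w - w') = 0"
    by (simp add: algebra_simps)
  moreover have "rf_eval (b - b') 0 = 0"
    using rf_eval_diff[OF assms(3,9), of 0] assms by simp
  ultimately have "a - a' = 0 \<and> b - b' = 0 \<and> w - w' = 0"
    using assms
    by (intro sum_poles_in_eq_0 poles_in_diff strictly_proper_diff proper_diff)
  then show "a = a' \<and> b = b' \<and> w = w'" by simp
qed auto

text \<open>Linear factors are split off one by one, each going to \<open>q1\<close> or
  \<open>q2\<close> according to its root; the leading constant ends up in
  \<open>q1\<close>.\<close>

lemma poly_factor_roots:
  fixes q :: "complex poly"
  assumes "q \<noteq> 0"
  shows "\<exists>q1 q2. q = q1 * q2 \<and> (\<forall>z. poly q1 z = 0 \<longrightarrow> z \<in> S) \<and> (\<forall>z. poly q2 z = 0 \<longrightarrow> z \<notin> S)"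
  using assms
proof (induction "degree q" arbitrary: q)
  case 0
  then obtain c where "q = [:c:]" "c \<noteq> 0"
    by (metis degree_eq_zeroE pCons_0_0)
  then show ?case
    by (intro exI[of _ q] exI[of _ 1]) auto
next
  case (Suc n)
  then obtain a where "poly q a = 0"
    using alg_closed_imp_poly_has_root[of q] by auto
  then obtain r where r: "q = [:- a, 1:] * r"
    by (auto simp: poly_eq_0_iff_dvd)
  with Suc.prems have "r \<noteq> 0" by auto
  moreover from this have "degree q = Suc (degree r)"
    unfolding r by (subst degree_mult_eq) auto
  ultimately obtain q1 q2 where q: "r = q1 * q2"
      "\<forall>z. poly q1 z = 0 \<longrightarrow> z \<in> S" "\<forall>z. poly q2 z = 0 \<longrightarrow> z \<notin> S"
    using Suc.hyps(1)[of r] Suc.hyps(2) by auto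
  show ?case
  proof (cases "a \<in> S")
    case True
    then show ?thesis
      using q r by (intro exI[of _ "[:- a, 1:] * q1"] exI[of _ q2]) (auto simp del: mult_pCons_left)
  next
    case False
    then show ?thesis
      using q r by (intro exI[of _ q1] exI[of _ "[:- a, 1:] * q2"])
        (auto simp del: mult_pCons_left simp: mult.left_commute)
  qed
qed

text \<open>Partial fractions: if \<open>u * q1 + v * q2 = 1\<close>, then p / (q1 q2) = p v / q1 +
  p u / q2.\<close>

lemma poles_in_split:
  assumes "poles_in U f"
  obtains g h where "f = g + h" "poles_in S g" "strictly_proper g" "poles_in (U - S) h"
proof (cases f rule: rf_cases)
  case (1 p q)
  obtain q1 q2 where q: "q = q1 * q2" "\<And>z. poly q1 z = 0 \<Longrightarrow> z \<in> S" "\<And>z. poly q2 z = 0 \<Longrightarrow> z \<notin> S"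
    using poly_factor_roots[OF 1(2), of S] by blast
  with 1(2) have nz: "q1 \<noteq> 0" "q2 \<noteq> 0" by auto
  \<comment> \<open>A common divisor has no root, since its roots would lie both in \<open>S\<close>
    and outside \<open>S\<close>; so it is constant.\<close>
  have "coprime q1 q2"
  proof (rule coprimeI)
    fix d assume d: "d dvd q1" "d dvd q2"
    with nz have "d \<noteq> 0" by auto
    moreover have "poly d z \<noteq> 0" for z
      using d q(2,3)[of z] by (auto simp: dvd_def)
    ultimately show "is_unit d"
      using alg_closed_imp_poly_has_root[of d] by (auto simp: is_unit_iff_degree)
  qed
  then obtain u v where uv: "u * q1 + v * q2 = 1"
    using bezout_coefficients_fst_snd[of q1 q2] by (auto simp: coprime_iff_gcd_eq_1)
  \<comment> \<open>Keeping only the remainder over \<open>q1\<close> makes \<open>g\<close>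
    strictly proper; the polynomial part \<open>s\<close> moves to \<open>h\<close>, where it adds
    no finite pole.\<close>
  define r s where "r = p * v mod q1" and "s = p * v div q1"
  define g h where "g = Fract r q1" and "h = Fract (p * u + s * q2) q2"
  have pv: "p * v = s * q1 + r"
    by (simp add: r_def s_def)
  have "r * q2 + (p * u + s * q2) * q1 = p * v * q2 + p * u * q1"
    unfolding pv by (simp add: algebra_simps)
  also have "\<dots> = p * (u * q1 + v * q2)"
    by (simp add: algebra_simps)
  finally have "r * q2 + (p * u + s * q2) * q1 = p"
    by (simp add: uv)
  then have "f = g + h"
    using 1(1) q(1) nz by (simp add: g_def h_def)
  moreover have "poles_in S g"
    unfolding g_def using nz(1) q(2) by (rule poles_in_Fract)
  moreover have "strictly_proper g"
    unfolding g_def using nz degree_mod_less[OF nz(1), of "p * v"]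
    by (simp add: strictly_proper_Fract r_def)
  moreover have "poles_in (U - S) h"
    unfolding h_def using nz q assms 1(4)
    by (intro poles_in_Fract) (auto simp: poles_in_def)
  ultimately show ?thesis by (rule that)
qed

lemma decomposition_exists:
  obtains a b c d where "f = a + b + c + rf_const d"
    "poles_in {z. cmod z < 1} a" "strictly_proper a"
    "poles_in {z. cmod z > 1} b" "rf_eval b 0 = 0"
    "poles_in {z. cmod z = 1} c" "strictly_proper c"
proof -
  have "poles_in UNIV f" by (simp add: poles_in_def)
  then obtain a h where a: "f = a + h" "poles_in {z. cmod z < 1} a" "strictly_proper a"
    and h: "poles_in (UNIV - {z. cmod z < 1}) h"
    using poles_in_split by metis
  from h obtain c k where c: "h = c + k" "poles_in {z. cmod z = 1} c" "strictly_proper c"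
    and k: "poles_in ((UNIV - {z. cmod z < 1}) - {z. cmod z = 1}) k"
    using poles_in_split by metis
  \<comment> \<open>What remains has its poles outside the closed disk, so it is regular at 0;
    subtracting its value there normalises it.\<close>
  define d where "d = rf_eval k 0"
  have k: "poles_in {z. cmod z > 1} k"
    using k by (rule poles_in_mono) auto
  have "rf_eval (k - rf_const d) 0 = 0"
    by (subst rf_eval_diff[OF k]) (auto simp: d_def)
  moreover have "f = a + (k - rf_const d) + c + rf_const d"
    by (simp add: a(1) c(1))
  ultimately show ?thesis
    using that[of a "k - rf_const d" c d] a c k by (simp add: poles_in_diff)
qed

section \<open>Conjugation of the coefficients\<close>

lemma map_poly_cnj_add: "map_poly cnj (p + q) = map_poly cnj p + map_poly cnj q"
  by (rule poly_eqI) (simp add: coeff_map_poly)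

lemma map_poly_cnj_uminus: "map_poly cnj (- p) = - map_poly cnj p"
  by (rule poly_eqI) (simp add: coeff_map_poly)

lemma map_poly_cnj_mult: "map_poly cnj (p * q) = map_poly cnj p * map_poly cnj q"
  by (rule poly_eqI) (simp add: coeff_map_poly coeff_mult)

lemma map_poly_cnj_cnj [simp]: "map_poly cnj (map_poly cnj p) = p"
  by (rule poly_eqI) (simp add: coeff_map_poly)

lemma degree_map_poly_cnj [simp]: "degree (map_poly cnj p) = degree p"
  by (rule degree_map_poly) simp

lemma map_poly_cnj_eq_0_iff [simp]: "map_poly cnj p = 0 \<longleftrightarrow> p = 0"
  by (simp add: map_poly_eq_0_iff)

text \<open>Conjugating the coefficients is multiplicative, so it respects cross-multiplication and
  may be computed on any fraction.\<close>

lemma rf_cnj_Fract: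
  assumes "q \<noteq> 0"
  shows "rf_cnj (Fract p q) = Fract (map_poly cnj p) (map_poly cnj q)"
  unfolding rf_cnj_def using assms Fract_lowest_terms[OF assms, of p]
  by (simp add: eq_fract flip: map_poly_cnj_mult)

lemma rf_cnj_cnj [simp]: "rf_cnj (rf_cnj f) = f"
  by (cases f rule: rf_cases) (simp add: rf_cnj_Fract)

lemma rf_cnj_add: "rf_cnj (f + g) = rf_cnj f + rf_cnj g"
  by (cases f rule: rf_cases; cases g rule: rf_cases)
    (simp add: rf_cnj_Fract map_poly_cnj_add map_poly_cnj_mult)

lemma rf_cnj_uminus: "rf_cnj (- f) = - rf_cnj f"
  by (cases f rule: rf_cases) (simp add: rf_cnj_Fract map_poly_cnj_uminus)

text \<open>The poles get conjugated. The closure condition on \<open>S\<close> holds for each of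
  the three regions, as they depend on the modulus alone.\<close>

lemma poles_in_cnj:
  assumes "poles_in S f" "\<And>z. cnj z \<in> S \<Longrightarrow> z \<in> S"
  shows "poles_in S (rf_cnj f)"
  using assms unfolding rf_cnj_def by (intro poles_in_Fract) (auto simp: poles_in_def)

lemma proper_cnj: "proper f \<Longrightarrow> proper (rf_cnj f)"
  by (cases f rule: rf_cases) (simp add: rf_cnj_Fract proper_Fract)

lemma strictly_proper_cnj: "strictly_proper f \<Longrightarrow> strictly_proper (rf_cnj f)"
  by (cases f rule: rf_cases) (simp add: rf_cnj_Fract strictly_proper_Fract)

lemma rf_eval_cnj:
  assumes "poles_in S f" "cnj z \<notin> S"
  shows "rf_eval (rf_cnj f) z = cnj (rf_eval f (cnj z))"
proof -
  have "poly (rf_den f) (cnj z) \<noteq> 0"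
    using assms by (auto simp: poles_in_def)
  then show ?thesis
    unfolding rf_cnj_def by (subst rf_eval_Fract) (simp_all add: rf_eval_def)
qed

section \<open>Substitution of the reciprocal\<close>

definition rf_recip :: "rat_fun \<Rightarrow> rat_fun" where
  "rf_recip f = rf_subst f (1 / rf_var)"

definition poly_recip :: "complex poly \<Rightarrow> rat_fun" where
  "poly_recip p = poly (map_poly rf_const p) (1 / rf_var)"

text \<open>This is p(1/t) = t^(-n) (t^n p(1/t)) with n = \<open>degree p\<close>; the bracket is p
  with its coefficients reversed. The induction substitutes 1/t in the Horner form a + t
  p(t).\<close>

lemma poly_recip_conv: "poly_recip p = Fract (reflect_poly p) (monom 1 (degree p))"
proof (induction p)
  case 0
  show ?case by (simp add: poly_recip_def fract_collapse)
next
  case (pCons a p)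
  have "poly_recip (pCons a p) = rf_const a + 1 / rf_var * poly_recip p"
    by (simp add: poly_recip_def map_poly_pCons)
  also have "\<dots> = Fract (reflect_poly (pCons a p)) (monom 1 (degree (pCons a p)))"
  proof (cases "p = 0")
    case True
    then show ?thesis
      by (simp add: poly_recip_def rf_const_def to_fract_def)
  next
    case False
    have var: "1 / rf_var = Fract 1 [:0, 1:]"
      by (simp add: rf_var_def to_fract_def One_fract_def)
    have mon: "[:0, 1:] * monom 1 n = (monom 1 (Suc n) :: complex poly)" for n
      by (simp add: monom_Suc)
    have "monom a n = [:a:] * monom 1 n" for n
      by (simp add: smult_monom)
    with False show ?thesis
      unfolding pCons.IH var rf_const_def to_fract_def
      by (simp add: reflect_poly_pCons' mon monom_Suc add.commute)
  qed
  finally show ?case .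
qed

lemma poly_recip_eq_0_iff [simp]: "poly_recip p = 0 \<longleftrightarrow> p = 0"
  by (simp add: poly_recip_conv Fract_eq_0_iff monom_eq_0_iff)

lemma poly_recip_add: "poly_recip (p + q) = poly_recip p + poly_recip q"
proof -
  have "map_poly rf_const (p + q) = map_poly rf_const p + map_poly rf_const q"
    by (rule poly_eqI) (simp add: coeff_map_poly rf_const_add)
  then show ?thesis by (simp add: poly_recip_def)
qed

lemma poly_recip_uminus: "poly_recip (- p) = - poly_recip p"
proof -
  have "poly_recip (- p) + poly_recip p = poly_recip 0"
    by (simp flip: poly_recip_add)
  then show ?thesis
    by (simp only: poly_recip_eq_0_iff eq_neg_iff_add_eq_0)
qed

lemma poly_recip_mult: "poly_recip (p * q) = poly_recip p * poly_recip q"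
  by (cases "p = 0 \<or> q = 0")
    (auto simp: poly_recip_conv reflect_poly_mult degree_mult_eq mult_monom fract_collapse)

text \<open>\<open>poly_recip\<close> is multiplicative and sends only 0 to 0, so it extends to
  fractions independently of the representation.\<close>

lemma rf_recip_Fract:
  assumes "q \<noteq> 0"
  shows "rf_recip (Fract p q) = poly_recip p / poly_recip q"
proof -
  have "poly_recip (rf_num (Fract p q)) * poly_recip q =
      poly_recip p * poly_recip (rf_den (Fract p q))"
    by (simp add: Fract_lowest_terms[OF assms] flip: poly_recip_mult)
  then show ?thesis
    using assms by (simp add: rf_recip_def rf_subst_def frac_eq_eq flip: poly_recip_def)
qed

lemma rf_recip_Fract_reflect:
  assumes "q \<noteq> 0"
  shows "rf_recip (Fract p q) =
    Fract (monom 1 (degree q) * reflect_poly p) (monom 1 (degree p) * reflect_poly q)"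
  using assms by (simp add: rf_recip_Fract poly_recip_conv mult.commute)

text \<open>For a proper fraction the powers of t cancel from the denominator. What is left,
  \<open>reflect_poly q\<close>, does not vanish at 0, where its value is the leading coefficient of
  \<open>q\<close>.\<close>

lemma rf_recip_Fract_reflect_proper:
  assumes "q \<noteq> 0" "degree p \<le> degree q"
  shows "rf_recip (Fract p q) = Fract (monom 1 (degree q - degree p) * reflect_poly p) (reflect_poly q)"
proof -
  have "monom 1 (degree q) = monom 1 (degree p) * (monom 1 (degree q - degree p) :: complex poly)"
    using assms by (simp add: mult_monom)
  then show ?thesis
    using assms by (simp add: rf_recip_Fract_reflect eq_fract monom_eq_0_iff algebra_simps)
qed

lemma rf_recip_0 [simp]: "rf_recip 0 = 0"
  by (simp add: rf_recip_def rf_subst_def)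

lemma rf_recip_add: "rf_recip (f + g) = rf_recip f + rf_recip g"
  by (cases f rule: rf_cases; cases g rule: rf_cases)
    (simp add: rf_recip_Fract poly_recip_add poly_recip_mult add_frac_eq)

lemma rf_recip_uminus: "rf_recip (- f) = - rf_recip f"
  by (cases f rule: rf_cases) (simp add: rf_recip_Fract poly_recip_uminus)

lemma poly_recip_monom: "poly_recip (monom a n) = Fract [:a:] (monom 1 n)"
proof (cases "a = 0")
  case False
  then have "reflect_poly (monom a n) = [:a:]"
    by (intro poly_eqI) (auto simp: coeff_reflect_poly degree_monom_eq coeff_pCons split: nat.splits)
  with False show ?thesis
    by (simp add: poly_recip_conv degree_monom_eq)
qed (simp add: fract_collapse)

text \<open>Reversing twice does not return \<open>p\<close> if p(0) = 0, because the degree drops.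
  The identity still holds in that case and is therefore proved by its own induction.\<close>

lemma poly_recip_reflect_poly: "poly_recip (reflect_poly p) = Fract p (monom 1 (degree p))"
proof (induction p)
  case 0
  show ?case by (simp add: fract_collapse)
next
  case (pCons a p)
  show ?case
  proof (cases "p = 0")
    case True
    then show ?thesis
      using poly_recip_monom[of a 0] by (simp add: monom_0)
  next
    case False
    have "poly_recip (reflect_poly (pCons a p)) =
        Fract p (monom 1 (degree p)) + Fract [:a:] (monom 1 (Suc (degree p)))"
      using False by (simp add: reflect_poly_pCons' poly_recip_add pCons.IH poly_recip_monom)
    also have "\<dots> = Fract (pCons a p) (monom 1 (Suc (degree p)))"
    proof -
      have "Fract p t + Fract b (x * t) = Fract (b + x * p) (x * t)"
        if "t \<noteq> 0" "x \<noteq> 0" for b t x :: "complex poly"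
        using that by (simp add: eq_fract algebra_simps)
      from this[of "monom 1 (degree p)" "[:0, 1:]" "[:a:]"] show ?thesis
        by (simp add: monom_Suc monom_eq_0_iff)
    qed
    finally show ?thesis using False by simp
  qed
qed

lemma rf_recip_recip [simp]: "rf_recip (rf_recip f) = f"
proof (cases f rule: rf_cases)
  case (1 p q)
  then have "rf_recip (rf_recip f) = poly_recip (monom 1 (degree q) * reflect_poly p) /
      poly_recip (monom 1 (degree p) * reflect_poly q)"
    by (simp add: rf_recip_Fract_reflect[OF 1(2)]) (simp add: rf_recip_Fract monom_eq_0_iff)
  also have "\<dots> = f"
    using 1(2) by (simp add: 1(1) poly_recip_mult poly_recip_monom poly_recip_reflect_poly
        monom_eq_0_iff eq_fract)
  finally show ?thesis .
qed

text \<open>Conjugation fixes the powers of t and commutes with reversing the coefficients.\<close>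

lemma rf_recip_cnj: "rf_recip (rf_cnj f) = rf_cnj (rf_recip f)"
proof (cases f rule: rf_cases)
  case (1 p q)
  have "map_poly cnj (reflect_poly r) = reflect_poly (map_poly cnj r)" for r
    by (rule poly_eqI) (simp add: coeff_map_poly coeff_reflect_poly)
  then show ?thesis
    using 1(2) unfolding 1(1)
    by (simp add: rf_cnj_Fract rf_recip_Fract_reflect map_poly_cnj_mult map_poly_monom monom_eq_0_iff)
qed

section \<open>Effect of t -> 1/t on poles, properness and the value at 0\<close>

lemma reflect_poly_root:
  fixes q :: "complex poly"
  assumes "q \<noteq> 0" "poly (reflect_poly q) z = 0"
  shows "z \<noteq> 0 \<and> poly q (inverse z) = 0"
  using assms by (cases "z = 0") (auto simp: poly_reflect_poly_nz)

lemma poles_in_recip_proper: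
  assumes "poles_in S f" "proper f"
  shows "poles_in {z. z \<noteq> 0 \<and> inverse z \<in> S} (rf_recip f)"
proof (cases f rule: rf_cases)
  case (1 p q)
  with assms have "degree p \<le> degree q"
    by (simp add: proper_Fract)
  with 1 assms reflect_poly_root[OF 1(2)] show ?thesis
    by (auto simp: rf_recip_Fract_reflect_proper poles_in_def[of S] intro!: poles_in_Fract)
qed

text \<open>Without properness, a pole of \<open>f\<close> at infinity becomes a pole at 0, which is
  why 0 joins the set.\<close>

lemma poles_in_recip:
  assumes "poles_in S f"
  shows "poles_in ({0} \<union> {z. z \<noteq> 0 \<and> inverse z \<in> S}) (rf_recip f)"
proof (cases f rule: rf_cases)
  case (1 p q)
  with assms reflect_poly_root[OF 1(2)] show ?thesis
    by (auto simp: rf_recip_Fract_reflect poles_in_def[of S] monom_eq_0_iff poly_monom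
        intro!: poles_in_Fract)
qed

lemma rf_eval_recip_0:
  assumes "strictly_proper f"
  shows "rf_eval (rf_recip f) 0 = 0"
proof (cases f rule: rf_cases)
  case (1 p q)
  with assms have "p = 0 \<or> degree p < degree q"
    by (simp add: strictly_proper_Fract)
  with 1 show ?thesis
    by (cases "p = 0")
      (auto simp: rf_recip_Fract_reflect_proper rf_eval_Fract poly_monom fract_collapse
        rf_eval_def[of 0])
qed

lemma strictly_proper_recip:
  assumes "poles_in S f" "0 \<notin> S" "rf_eval f 0 = 0"
  shows "strictly_proper (rf_recip f)"
proof (cases f rule: rf_cases)
  case (1 p q)
  with assms have q: "poly q 0 \<noteq> 0"
    by (auto simp: poles_in_def)
  with 1 assms have p: "poly p 0 = 0"
    by (simp add: rf_eval_Fract)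
  show ?thesis
  proof (cases "p = 0")
    case False
    \<comment> \<open>A zero of \<open>p\<close> at 0 lowers the degree of its reversal, whereas
      \<open>reflect_poly q\<close> keeps the degree of \<open>q\<close> because q(0) is
      nonzero.\<close>
    have "degree (reflect_poly p) < degree p"
    proof -
      have "degree p \<noteq> 0"
        using p False by (metis degree_eq_zeroE mult_zero_left pCons_0_0 poly_const_conv)
      moreover have "coeff (reflect_poly p) (degree p) = 0"
        using p by (simp add: coeff_reflect_poly poly_0_coeff_0)
      ultimately show ?thesis
        using degree_reflect_poly_le[of p] False
        by (metis le_neq_implies_less leading_coeff_0_iff reflect_poly_eq_0_iff)
    qed
    then show ?thesis
      using 1 q False
      by (simp add: rf_recip_Fract_reflect strictly_proper_Fract monom_eq_0_iff degree_mult_eq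
          degree_monom_eq poly_0_coeff_0)
  qed (use 1 in \<open>simp add: strictly_proper_def fract_collapse\<close>)
qed

text \<open>Regularity of \<open>f\<close> at 0 turns into a finite limit of f(1/t) at
  infinity.\<close>

lemma proper_recip:
  assumes "poles_in S f" "0 \<notin> S"
  shows "proper (rf_recip f)"
proof (cases f rule: rf_cases)
  case (1 p q)
  with assms have "coeff q 0 \<noteq> 0"
    by (auto simp: poles_in_def poly_0_coeff_0)
  then show ?thesis
    using 1 degree_reflect_poly_le[of p]
    by (cases "p = 0") (auto simp: rf_recip_Fract_reflect proper_Fract monom_eq_0_iff
        degree_mult_eq degree_monom_eq fract_collapse proper_def[of 0])
qed

section \<open>The decomposition of a rational matrix\<close>

definition scalar_decomposition ::
  "rat_fun \<Rightarrow> rat_fun \<Rightarrow> rat_fun \<Rightarrow> rat_fun \<Rightarrow> complex \<Rightarrow> bool" where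
  "scalar_decomposition f a b c d \<longleftrightarrow> f = a + b + c + rf_const d \<and>
    strictly_proper a \<and> poles_in {z. cmod z < 1} a \<and>
    rf_eval b 0 = 0 \<and> poles_in {z. cmod z > 1} b \<and>
    strictly_proper c \<and> poles_in {z. cmod z = 1} c"

lemma scalar_decomposition_unique:
  assumes "scalar_decomposition f a b c d" "scalar_decomposition f a' b' c' d'"
  shows "a = a' \<and> b = b' \<and> c = c' \<and> d = d'"
proof -
  have "a + b + (c + rf_const d) = a' + b' + (c' + rf_const d')"
    using assms by (simp add: scalar_decomposition_def add.assoc)
  then have *: "a = a' \<and> b = b' \<and> c + rf_const d = c' + rf_const d'"
    using assms unfolding scalar_decomposition_def
    by (subst (asm) decomposition_unique)
      (auto intro!: poles_in_add proper_add_const)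
  \<comment> \<open>The circle parts agree only with their constants included. A constant that is a
    difference of strictly proper functions vanishes, which separates the two.\<close>
  then have "rf_const (d' - d) = c - c'"
    by (simp add: rf_const_diff algebra_simps)
  moreover have "strictly_proper (c - c')"
    using assms by (auto simp: scalar_decomposition_def intro: strictly_proper_diff)
  ultimately have "d' = d"
    by (metis strictly_proper_const_iff eq_iff_diff_eq_0)
  with * show ?thesis by simp
qed

lemma scalar_decomposition_uminus:
  "scalar_decomposition f a b c d \<Longrightarrow> scalar_decomposition (- f) (- a) (- b) (- c) (- d)"
  by (simp add: scalar_decomposition_def rf_const_uminus)

text \<open>Both sides decompose over the same three regions, but inversion swaps inside and
  outside, so \<open>a\<close> is matched with \<open>b'\<close> and \<open>b\<close> with
  \<open>a'\<close>. Two functions are needed since the matrix star relates entry (j, i) to entry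
  (i, j).\<close>

lemma cnj_eq_recip_iff:
  assumes "scalar_decomposition f a b c d" "scalar_decomposition g a' b' c' d'"
  shows "rf_cnj f = rf_recip g \<longleftrightarrow> rf_cnj a = rf_recip b' \<and> rf_cnj b = rf_recip a' \<and>
    rf_cnj (c + rf_const d) = rf_recip (c' + rf_const d')"
proof -
  note [simp] = assms[unfolded scalar_decomposition_def]
  have w: "poles_in {z. cmod z = 1} (c + rf_const d)" "proper (c + rf_const d)"
      "poles_in {z. cmod z = 1} (c' + rf_const d')" "proper (c' + rf_const d')"
    by (auto intro!: poles_in_add proper_add_const)
  have "rf_cnj f = rf_cnj a + rf_cnj b + rf_cnj (c + rf_const d)"
    using assms(1) by (simp add: scalar_decomposition_def add.assoc flip: rf_cnj_add)
  moreover have "rf_recip g = rf_recip b' + rf_recip a' + rf_recip (c' + rf_const d')"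
    using assms(2) by (simp add: scalar_decomposition_def ac_simps flip: rf_recip_add)
  moreover have "rf_cnj a + rf_cnj b + rf_cnj (c + rf_const d) =
      rf_recip b' + rf_recip a' + rf_recip (c' + rf_const d') \<longleftrightarrow>
      rf_cnj a = rf_recip b' \<and> rf_cnj b = rf_recip a' \<and>
      rf_cnj (c + rf_const d) = rf_recip (c' + rf_const d')"
  proof (rule decomposition_unique)
    show "poles_in {z. cmod z < 1} (rf_cnj a)" "poles_in {z. cmod z > 1} (rf_cnj b)"
        "poles_in {z. cmod z = 1} (rf_cnj (c + rf_const d))"
      using w by (auto intro!: poles_in_cnj)
    show "strictly_proper (rf_cnj a)" "proper (rf_cnj (c + rf_const d))"
      using w by (auto intro!: strictly_proper_cnj proper_cnj)
    show "rf_eval (rf_cnj b) 0 = 0"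
      by (subst rf_eval_cnj[of "{z. cmod z > 1}"]) auto
    \<comment> \<open>The function \<open>b'\<close> may have a pole at infinity; the resulting pole
      at 0 is harmless inside the disk.\<close>
    show "poles_in {z. cmod z < 1} (rf_recip b')"
      by (rule poles_in_mono[OF poles_in_recip[of "{z. cmod z > 1}"]])
        (auto simp: norm_inverse one_less_inverse_iff)
    show "strictly_proper (rf_recip b')"
      by (rule strictly_proper_recip[of "{z. cmod z > 1}"]) auto
    \<comment> \<open>Here 0 must be excluded as a pole, which properness of \<open>a'\<close>
      guarantees.\<close>
    show "poles_in {z. cmod z > 1} (rf_recip a')"
      by (rule poles_in_mono[OF poles_in_recip_proper[of "{z. cmod z < 1}"]])
        (auto simp: norm_inverse inverse_less_1_iff strictly_proper_imp_proper)
    show "rf_eval (rf_recip a') 0 = 0"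
      by (simp add: rf_eval_recip_0)
    show "poles_in {z. cmod z = 1} (rf_recip (c' + rf_const d'))"
      using w by (intro poles_in_mono[OF poles_in_recip_proper[of "{z. cmod z = 1}"]])
        (auto simp: norm_inverse)
    show "proper (rf_recip (c' + rf_const d'))"
      using w by (intro proper_recip[of "{z. cmod z = 1}"]) auto
  qed
  ultimately show ?thesis by simp
qed

section \<open>From entries to matrices\<close>

lemma eq_mat_iff:
  assumes "A \<in> carrier_mat m n" "B \<in> carrier_mat m n"
  shows "A = B \<longleftrightarrow> (\<forall>i<m. \<forall>j<n. A $$ (i, j) = B $$ (i, j))"
  using assms by auto

lemma rm_poles_iff:
  assumes "A \<in> carrier_mat m n"
  shows "(\<forall>z\<in>rm_poles A. P z) \<longleftrightarrow> (\<forall>i<m. \<forall>j<n. poles_in {z. P z} (A $$ (i, j)))"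
  using assms by (auto simp: rm_poles_def is_pole_rf_eval_iff poles_in_def)

lemma rm_strictly_proper_iff:
  assumes "A \<in> carrier_mat m n"
  shows "rm_strictly_proper A \<longleftrightarrow> (\<forall>i<m. \<forall>j<n. strictly_proper (A $$ (i, j)))"
  using assms by (auto simp: rm_strictly_proper_def rf_eval_tendsto_0_iff)

lemma circle_decomposition_iff:
  assumes "R \<in> carrier_mat m n"
  shows "circle_decomposition R Rin Rout RS R0 \<longleftrightarrow>
    Rin \<in> carrier_mat m n \<and> Rout \<in> carrier_mat m n \<and> RS \<in> carrier_mat m n \<and> R0 \<in> carrier_mat m n \<and>
    (\<forall>i<m. \<forall>j<n. scalar_decomposition (R $$ (i, j))
      (Rin $$ (i, j)) (Rout $$ (i, j)) (RS $$ (i, j)) (R0 $$ (i, j)))"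
proof (cases "Rin \<in> carrier_mat m n \<and> Rout \<in> carrier_mat m n \<and> RS \<in> carrier_mat m n \<and>
    R0 \<in> carrier_mat m n")
  case True
  then have car: "Rin \<in> carrier_mat m n" "Rout \<in> carrier_mat m n" "RS \<in> carrier_mat m n"
    "R0 \<in> carrier_mat m n" by auto
  have "R = Rin + Rout + RS + rm_const R0 \<longleftrightarrow> (\<forall>i<m. \<forall>j<n. R $$ (i, j) =
      Rin $$ (i, j) + Rout $$ (i, j) + RS $$ (i, j) + rf_const (R0 $$ (i, j)))"
    using car by (subst eq_mat_iff[OF assms]) (auto simp: rm_const_def)
  moreover have "rm_eval Rout 0 = 0\<^sub>m m n \<longleftrightarrow> (\<forall>i<m. \<forall>j<n. rf_eval (Rout $$ (i, j)) 0 = 0)"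
    using car by (subst eq_mat_iff[of _ m n]) (auto simp: rm_eval_def)
  moreover have "dim_row R = m" "dim_col R = n"
    using assms by auto
  ultimately show ?thesis
    using car unfolding circle_decomposition_def scalar_decomposition_def
    by (simp only: rm_poles_iff[OF car(1)] rm_poles_iff[OF car(2)] rm_poles_iff[OF car(3)]
        rm_strictly_proper_iff[OF car(1)] rm_strictly_proper_iff[OF car(3)]
        imp_conjR all_conj_distrib simp_thms)
next
  case False
  then show ?thesis
    using assms unfolding circle_decomposition_def by auto
qed

lemma circle_decomposition_exists: "\<exists>Rin Rout RS R0. circle_decomposition R Rin Rout RS R0"
proof -
  have "\<exists>a b c d. scalar_decomposition f a b c d" for f
    unfolding scalar_decomposition_def by (rule decomposition_exists[of f]) blast
  then obtain a b c d where "\<And>f. scalar_decomposition f (a f) (b f) (c f) (d f)"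
    by metis
  then have "circle_decomposition R (map_mat a R) (map_mat b R) (map_mat c R) (map_mat d R)"
    by (simp add: circle_decomposition_iff[of R "dim_row R" "dim_col R"])
  then show ?thesis by blast
qed

lemma circle_decomposition_unique:
  assumes "circle_decomposition R Rin Rout RS R0" "circle_decomposition R Rin' Rout' RS' R0'"
  shows "Rin = Rin' \<and> Rout = Rout' \<and> RS = RS' \<and> R0 = R0'"
proof -
  have R: "R \<in> carrier_mat (dim_row R) (dim_col R)" by simp
  note D = assms[unfolded circle_decomposition_iff[OF R]]
  have "Rin $$ (i, j) = Rin' $$ (i, j) \<and> Rout $$ (i, j) = Rout' $$ (i, j) \<and>
      RS $$ (i, j) = RS' $$ (i, j) \<and> R0 $$ (i, j) = R0' $$ (i, j)"
    if "i < dim_row R" "j < dim_col R" for i j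
    using D that by (intro scalar_decomposition_unique) auto
  then show ?thesis
    using D by (auto simp: eq_mat_iff[of _ "dim_row R" "dim_col R"])
qed

lemma circle_decomposition_uminus:
  assumes "circle_decomposition R Rin Rout RS R0"
  shows "circle_decomposition (- R) (- Rin) (- Rout) (- RS) (- R0)"
proof -
  have R: "R \<in> carrier_mat (dim_row R) (dim_col R)" "- R \<in> carrier_mat (dim_row R) (dim_col R)"
    by auto
  note D = assms[unfolded circle_decomposition_iff[OF R(1)]]
  then have "dim_row A = dim_row R \<and> dim_col A = dim_col R" if "A \<in> {Rin, Rout, RS}" for A
    using that by auto
  moreover have "dim_row R0 = dim_row R" "dim_col R0 = dim_col R"
    using D by auto
  ultimately show ?thesis
    using D unfolding circle_decomposition_iff[OF R(2)]
    by (auto intro!: scalar_decomposition_uminus)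
qed

section \<open>Symmetry under the star and t -> 1/t\<close>

lemma rm_recip_conv: "rm_recip = map_mat rf_recip"
  by (intro ext) (simp add: rm_recip_def rf_recip_def[abs_def])

lemma rm_recip_uminus: "rm_recip (- A) = - rm_recip A"
  by (rule eq_matI) (auto simp: rm_recip_conv rf_recip_uminus)

lemma rm_star_uminus: "rm_star (- A) = - rm_star A"
  by (rule eq_matI) (auto simp: rm_star_def rf_cnj_uminus)

text \<open>Star and reciprocal are commuting involutions. This makes the condition on the star of
  \<open>Rout\<close> a consequence of the one on the star of \<open>Rin\<close>.\<close>

lemma rm_star_eq_recip_commute:
  assumes "rm_star A = rm_recip B"
  shows "rm_star B = rm_recip A"
proof -
  have "B = rm_recip (rm_recip B)"
    by (rule eq_matI) (auto simp: rm_recip_conv)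
  then have "rm_star B = rm_star (rm_recip (rm_star A))"
    by (simp flip: assms)
  also have "\<dots> = rm_recip A"
    by (rule eq_matI) (auto simp: rm_recip_conv rm_star_def rf_recip_cnj)
  finally show ?thesis .
qed

text \<open>A second matrix \<open>Q\<close> lets one statement serve both symmetries:
  \<open>Q = R\<close> for para-Hermitian and \<open>Q = - R\<close> for
  para-skew-Hermitian.\<close>

lemma rm_star_eq_recip_iff:
  assumes "R \<in> carrier_mat m m" "Q \<in> carrier_mat m m"
    and "circle_decomposition R Rin Rout RS R0" "circle_decomposition Q Qin Qout QS Q0"
  shows "rm_star R = rm_recip Q \<longleftrightarrow>
    rm_star Rin = rm_recip Qout \<and> rm_star Rout = rm_recip Qin \<and>
    rm_star (RS + rm_const R0) = rm_recip (QS + rm_const Q0)"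
proof -
  note D = assms(3)[unfolded circle_decomposition_iff[OF assms(1)]]
    assms(4)[unfolded circle_decomposition_iff[OF assms(2)]]
  have entry: "rm_star A = rm_recip B \<longleftrightarrow>
      (\<forall>i<m. \<forall>j<m. rf_cnj (A $$ (j, i)) = rf_recip (B $$ (i, j)))"
    if "A \<in> carrier_mat m m" "B \<in> carrier_mat m m" for A B
    using that by (subst eq_mat_iff[of _ m m]) (auto simp: rm_star_def rm_recip_conv)
  have c: "rm_const R0 \<in> carrier_mat m m" "rm_const Q0 \<in> carrier_mat m m"
    using D by (auto simp: rm_const_def)
  have "rf_cnj (R $$ (j, i)) = rf_recip (Q $$ (i, j)) \<longleftrightarrow>
      rf_cnj (Rin $$ (j, i)) = rf_recip (Qout $$ (i, j)) \<and>
      rf_cnj (Rout $$ (j, i)) = rf_recip (Qin $$ (i, j)) \<and>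
      rf_cnj ((RS + rm_const R0) $$ (j, i)) = rf_recip ((QS + rm_const Q0) $$ (i, j))"
    if "i < m" "j < m" for i j
  proof -
    have "(RS + rm_const R0) $$ (j, i) = RS $$ (j, i) + rf_const (R0 $$ (j, i))"
      "(QS + rm_const Q0) $$ (i, j) = QS $$ (i, j) + rf_const (Q0 $$ (i, j))"
      using D that by (auto simp: rm_const_def)
    then show ?thesis
      using D that by (simp only:) (intro cnj_eq_recip_iff, auto)
  qed
  then have "rm_star R = rm_recip Q \<longleftrightarrow> (\<forall>i<m. \<forall>j<m.
      rf_cnj (Rin $$ (j, i)) = rf_recip (Qout $$ (i, j)) \<and>
      rf_cnj (Rout $$ (j, i)) = rf_recip (Qin $$ (i, j)) \<and>
      rf_cnj ((RS + rm_const R0) $$ (j, i)) = rf_recip ((QS + rm_const Q0) $$ (i, j)))"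
    using entry[OF assms(1,2)] by simp
  also have "\<dots> \<longleftrightarrow> rm_star Rin = rm_recip Qout \<and> rm_star Rout = rm_recip Qin \<and>
      rm_star (RS + rm_const R0) = rm_recip (QS + rm_const Q0)"
  proof -
    have "Rin \<in> carrier_mat m m" "Rout \<in> carrier_mat m m" "RS + rm_const R0 \<in> carrier_mat m m"
      and "Qin \<in> carrier_mat m m" "Qout \<in> carrier_mat m m" "QS + rm_const Q0 \<in> carrier_mat m m"
      using D c by auto
    then show ?thesis
      by (simp only: entry imp_conjR all_conj_distrib)
  qed
  finally show ?thesis .
qed

theorem lemma5p1:
  fixes R :: "rat_fun mat" and m n :: nat
  assumes "R \<in> carrier_mat m n"
  shows "(\<exists>!D. case D of (Rin, Rout, RS, R0) \<Rightarrow> circle_decomposition R Rin Rout RS R0) \<and>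
    (m = n \<longrightarrow>
      (\<forall>Rin Rout RS R0. circle_decomposition R Rin Rout RS R0 \<longrightarrow>
        rm_proper (RS + rm_const R0) \<and>
        (para_hermitian R \<longleftrightarrow>
           rm_star Rin = rm_recip Rout \<and> para_hermitian (RS + rm_const R0)) \<and>
        (para_skew_hermitian R \<longleftrightarrow>
           rm_star Rin = - rm_recip Rout \<and> para_skew_hermitian (RS + rm_const R0))))"
proof (intro conjI impI allI)
  show "\<exists>!D. case D of (Rin, Rout, RS, R0) \<Rightarrow> circle_decomposition R Rin Rout RS R0"
  proof (rule ex_ex1I)
    show "\<exists>D. case D of (Rin, Rout, RS, R0) \<Rightarrow> circle_decomposition R Rin Rout RS R0"
      using circle_decomposition_exists[of R] by auto
  next
    fix D D'
    assume "case D of (Rin, Rout, RS, R0) \<Rightarrow> circle_decomposition R Rin Rout RS R0"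
      "case D' of (Rin, Rout, RS, R0) \<Rightarrow> circle_decomposition R Rin Rout RS R0"
    then show "D = D'"
      by (cases D; cases D') (auto dest: circle_decomposition_unique)
  qed
next
  fix Rin Rout RS R0
  assume "m = n" and D: "circle_decomposition R Rin Rout RS R0"
  then have R: "R \<in> carrier_mat m m" using assms by simp
  note D' = D[unfolded circle_decomposition_iff[OF R]]
  define W where "W = RS + rm_const R0"
  have W: "W \<in> carrier_mat m m"
    using D' by (auto simp: W_def rm_const_def)
  show "rm_proper (RS + rm_const R0)"
    unfolding rm_proper_def
  proof (intro allI impI)
    fix i j assume "i < dim_row (RS + rm_const R0)" "j < dim_col (RS + rm_const R0)"
    then have "(RS + rm_const R0) $$ (i, j) = RS $$ (i, j) + rf_const (R0 $$ (i, j))"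
      "strictly_proper (RS $$ (i, j))"
      using D' by (auto simp: rm_const_def scalar_decomposition_def)
    then show "\<exists>L. (rf_eval ((RS + rm_const R0) $$ (i, j)) \<longlongrightarrow> L) at_infinity"
      by (auto intro!: proper_imp_convergent proper_add_const)
  qed
  have sq: "square_mat R" "square_mat W"
    using R W by auto
  have "rm_star R = rm_recip R \<longleftrightarrow>
      rm_star Rin = rm_recip Rout \<and> rm_star W = rm_recip W"
    using rm_star_eq_recip_iff[OF R R D D] rm_star_eq_recip_commute[of Rin Rout]
    unfolding W_def by blast
  then show "para_hermitian R \<longleftrightarrow>
      rm_star Rin = rm_recip Rout \<and> para_hermitian (RS + rm_const R0)"
    using sq unfolding para_hermitian_def W_def by blast
  \<comment> \<open>For the skew case the sign is moved inside the reciprocal, and the componentwise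
    criterion is applied to \<open>R\<close> and \<open>- R\<close>, whose decomposition is the
    negated one.\<close>
  have W_uminus: "- RS + rm_const (- R0) = - W"
    using D' by (intro eq_matI) (auto simp: W_def rm_const_def rf_const_uminus)
  have "rm_star R = rm_recip (- R) \<longleftrightarrow>
      rm_star Rin = rm_recip (- Rout) \<and> rm_star Rout = rm_recip (- Rin) \<and>
      rm_star W = rm_recip (- W)"
    using rm_star_eq_recip_iff[OF R _ D circle_decomposition_uminus[OF D]] R
    unfolding W_uminus W_def[symmetric] by simp
  moreover have "rm_star Rout = rm_recip (- Rin)" if "rm_star Rin = rm_recip (- Rout)"
    using rm_star_eq_recip_commute[OF that] unfolding rm_star_uminus rm_recip_uminus
    by (metis uminus_uminus_mat)
  ultimately have "rm_star R = - rm_recip R \<longleftrightarrow>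
      rm_star Rin = - rm_recip Rout \<and> rm_star W = - rm_recip W"
    unfolding rm_recip_uminus by blast
  then show "para_skew_hermitian R \<longleftrightarrow>
      rm_star Rin = - rm_recip Rout \<and> para_skew_hermitian (RS + rm_const R0)"
    using sq unfolding para_skew_hermitian_def W_def by blast
qed

end
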